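(* Let $\beta\in(0,1)$ and let $L=L_\beta$. Let $n>2$ be an integer and let $D$ be a domain with an algebraic boundary of order $n$. Suppose that $D$ is $L$-special and that a pair of polynomials $(F_1,F_2)$ (polynomials in one complex variable with complex coefficients) is an admissible pair for $D$. Then $\max(\deg F_1,\deg F_2)>n$.
   Context: Identify $\mathbb{R}^2$ with $\mathbb{C}$ via $z=x+iy$. Operator. For $\beta\in(0,1)$, $L_\beta=c\,\overline{\partial}\,\partial_\beta$, where $c\in\mathbb{C}\setminus\{0\}$, $\overline{\partial}=\frac12(\partial/\partial x+i\,\partial/\partial y)$ and $\partial_\beta=\frac12(\partial/\partial x+i\beta\,\partial/\partial y)$. Associated with $L_\beta$ is the real-linear transformation of the plane $T_\beta: z=x+iy\mapsto z_\beta=x+\frac{i}{\beta}y$. Carathéodory domains and the class $AC$. A bounded domain $D\subset\mathbb{R}^2$ is a Carathéodory domain if $\partial D=\partial D_\infty$, where $D_\infty$ is the unbounded connected component of $\mathbb{R}^2\setminus\overline{D}$; such a domain is simply connected. Let $\varphi$ be a conformal mapping of the unit disc $\mathbb{D}=\{|z|<1\}$ onto $D$. A holomorphic function $f$ in $D$ belongs to $AC(D)$ if $f\circ\varphi$ extends to a function that is continuous on $\overline{\mathbb{D}}$ and absolutely continuous on the unit circle. For $f\in AC(D)$ and an accessible boundary point $\zeta$ of $D$, the limits of $f$ along all paths lying in $D\cup\{\zeta\}$ and ending at $\zeta$ exist and are equal to a common value, denoted $f(\zeta)$ (the boundary value of $f$ at $\zeta$). $L$-special domains. For $L=L_\beta$,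 a Carathéodory domain $D$ is $L$-special if there exist two non-constant functions $F_1\in AC(D)$ and $F_2\in AC(T_\beta D)$ such that $F_1(\zeta)=F_2(T_\beta\zeta)$ for every accessible boundary point $\zeta\in\partial D$. Any such pair $(F_1,F_2)$ is called admissible for $D$ (it is not unique). Algebraic boundaries. A Jordan curve $\varGamma\subset\mathbb{R}^2$ is algebraic if $\varGamma\subset\{(x,y)\in\mathbb{R}^2:P(x,y)=0\}$ for some nonzero $P\in\mathbb{C}[x,y]$; in this case one says that $P$ defines $\varGamma$. The order of an algebraic curve $\varGamma$ is the smallest $n$ such that there is a polynomial of degree $n$ defining $\varGamma$. A domain with an algebraic boundary is a Jordan domain that is the interior of a closed Jordan algebraic curve; the order of the boundary is the order of this curve. *)

theory Defs
  imports "HOL-Complex_Analysis.Complex_Analysis" "HOL-Computational_Algebra.Computational_Algebra"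
begin

(* The operator L = c * dbar * d_beta enters only through beta (the factor c is irrelevant),
   so the notions attached to L are parametrised by beta. *)

definition T_map :: "real \<Rightarrow> complex \<Rightarrow> complex" where
  "T_map \<beta> z = Complex (Re z) (Im z / \<beta>)"

(* For bounded D, outside (closure D) is the unique unbounded component of the
   complement of closure D. *)
definition Caratheodory_domain :: "complex set \<Rightarrow> bool" where
  "Caratheodory_domain D \<longleftrightarrow>
     open D \<and> connected D \<and> D \<noteq> {} \<and> bounded D \<and> frontier D = frontier (outside (closure D))"

definition abs_continuous_on_interval :: "real \<Rightarrow> real \<Rightarrow> (real \<Rightarrow> 'a::real_normed_vector) \<Rightarrow> bool" where
  "abs_continuous_on_interval a b h \<longleftrightarrow>
     (\<forall>\<epsilon>>0. \<exists>\<delta>>0. \<forall>(n::nat) (u::nat \<Rightarrow> real) (v::nat \<Rightarrow> real).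
        (\<forall>k<n. a \<le> u k \<and> u k \<le> v k \<and> v k \<le> b) \<and>
        disjoint_family_on (\<lambda>k. {u k<..<v k}) {..<n} \<and>
        (\<Sum>k<n. v k - u k) < \<delta>
        \<longrightarrow> (\<Sum>k<n. norm (h (v k) - h (u k))) < \<epsilon>)"

definition abs_continuous_on_unit_circle :: "(complex \<Rightarrow> complex) \<Rightarrow> bool" where
  "abs_continuous_on_unit_circle g \<longleftrightarrow> abs_continuous_on_interval 0 (2 * pi) (\<lambda>t. g (cis t))"

definition conformal_map_of_disc :: "(complex \<Rightarrow> complex) \<Rightarrow> complex set \<Rightarrow> bool" where
  "conformal_map_of_disc \<phi> D \<longleftrightarrow>
     \<phi> holomorphic_on ball 0 1 \<and> inj_on \<phi> (ball 0 1) \<and> \<phi> ` ball 0 1 = D"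

(* Two conformal maps of the disc onto D differ by a Moebius automorphism of the disc,
   so the choice of phi does not matter. *)
definition AC :: "complex set \<Rightarrow> (complex \<Rightarrow> complex) set" where
  "AC D = {f. f holomorphic_on D \<and>
     (\<exists>\<phi> g. conformal_map_of_disc \<phi> D \<and> continuous_on (cball 0 1) g \<and>
        (\<forall>w\<in>ball 0 1. g w = f (\<phi> w)) \<and> abs_continuous_on_unit_circle g)}"

definition access_path :: "complex set \<Rightarrow> complex \<Rightarrow> (real \<Rightarrow> complex) \<Rightarrow> bool" where
  "access_path D \<zeta> \<gamma> \<longleftrightarrow> path \<gamma> \<and> pathfinish \<gamma> = \<zeta> \<and> (\<forall>t\<in>{0..<1}. \<gamma> t \<in> D)"

definition accessible_boundary_points :: "complex set \<Rightarrow> complex set" where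
  "accessible_boundary_points D = {\<zeta> \<in> frontier D. \<exists>\<gamma>. access_path D \<zeta> \<gamma>}"

definition boundary_value :: "complex set \<Rightarrow> (complex \<Rightarrow> complex) \<Rightarrow> complex \<Rightarrow> complex" where
  "boundary_value D f \<zeta> =
     (THE v. \<forall>\<gamma>. access_path D \<zeta> \<gamma> \<longrightarrow> ((\<lambda>t. f (\<gamma> t)) \<longlongrightarrow> v) (at_left 1))"

definition admissible_pair ::
  "real \<Rightarrow> complex set \<Rightarrow> (complex \<Rightarrow> complex) \<Rightarrow> (complex \<Rightarrow> complex) \<Rightarrow> bool" where
  "admissible_pair \<beta> D F1 F2 \<longleftrightarrow>
     F1 \<in> AC D \<and> F2 \<in> AC (T_map \<beta> ` D) \<and>
     \<not> F1 constant_on D \<and> \<not> F2 constant_on (T_map \<beta> ` D) \<and>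
     (\<forall>\<zeta>\<in>accessible_boundary_points D.
        boundary_value D F1 \<zeta> = boundary_value (T_map \<beta> ` D) F2 (T_map \<beta> \<zeta>))"

definition L_special :: "real \<Rightarrow> complex set \<Rightarrow> bool" where
  "L_special \<beta> D \<longleftrightarrow> Caratheodory_domain D \<and> (\<exists>F1 F2. admissible_pair \<beta> D F1 F2)"

definition Jordan_curve :: "complex set \<Rightarrow> bool" where
  "Jordan_curve \<Gamma> \<longleftrightarrow> (\<exists>g. simple_path g \<and> pathfinish g = pathstart g \<and> path_image g = \<Gamma>)"

(* P in C[x,y] is encoded as an element of C[x][y]:
   coeff (coeff P j) i is the coefficient of x^i y^j. *)
definition eval_xy :: "complex poly poly \<Rightarrow> real \<Rightarrow> real \<Rightarrow> complex" where
  "eval_xy P x y = poly (poly P [:complex_of_real y:]) (complex_of_real x)"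

(* Meaningful for P \<noteq> 0 only. *)
definition total_degree :: "complex poly poly \<Rightarrow> nat" where
  "total_degree P = Max {i + j |i j. coeff (coeff P j) i \<noteq> 0}"

definition defines_curve :: "complex poly poly \<Rightarrow> complex set \<Rightarrow> bool" where
  "defines_curve P \<Gamma> \<longleftrightarrow> P \<noteq> 0 \<and> (\<forall>z\<in>\<Gamma>. eval_xy P (Re z) (Im z) = 0)"

definition algebraic_curve :: "complex set \<Rightarrow> bool" where
  "algebraic_curve \<Gamma> \<longleftrightarrow> Jordan_curve \<Gamma> \<and> (\<exists>P. defines_curve P \<Gamma>)"

definition curve_order :: "complex set \<Rightarrow> nat" where
  "curve_order \<Gamma> = (LEAST n. \<exists>P. defines_curve P \<Gamma> \<and> total_degree P = n)"

definition algebraic_boundary_of_order :: "complex set \<Rightarrow> nat \<Rightarrow> bool" where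
  "algebraic_boundary_of_order D n \<longleftrightarrow>
     (\<exists>\<Gamma>. algebraic_curve \<Gamma> \<and> D = inside \<Gamma> \<and> curve_order \<Gamma> = n)"

end

theory Submission
  imports Defs "HOL-Computational_Algebra.Field_as_Ring"
begin

(* The polynomial Q(x,y) = F1(x + iy) - F2(x + iy/beta) is nonzero, has degree at most
   max (deg F1) (deg F2), and vanishes on the boundary curve, because boundary values of polynomials
   are their values and accessible points are dense in the boundary. So the maximum is at least n.
   If it equals n, then Q and its coefficientwise conjugate Q* are both defining polynomials of
   minimal degree; since coprime bivariate polynomials have finitely many common zeros and a Jordan
   curve has no isolated points, Q and Q* are proportional. But for k > 2 the k-th powers of the four
   linear forms x + iy, x + iy/beta, x - iy, x - iy/beta are linearly independent, so proportionality
   forces the coefficients of F1 and F2 in degree n > 2 to vanish. *)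

section \<open>Coprime bivariate polynomials\<close>

text \<open>This is Bezout's identity over the fraction field with denominators cleared. Take a
  nonzero \<open>D\<close> of least degree in the ideal generated by \<open>A\<close> and
  \<open>B\<close>: its primitive part divides every element of the ideal, hence is a unit, so
  \<open>D\<close> is a constant polynomial.\<close>

lemma bezout_coprime_poly:
  fixes A B :: "'a::{factorial_ring_gcd,semiring_gcd_mult_normalize} poly"
  assumes "coprime A B"
  shows "\<exists>U V d. d \<noteq> 0 \<and> U * A + V * B = [:d:]"
proof -
  define I where "I = {U * A + V * B | U V. True}"
  have "A = 1 * A + 0 * B" "B = 0 * A + 1 * B" by simp_all
  then have AI: "A \<in> I" and BI: "B \<in> I" unfolding I_def by blast+
  have "A \<noteq> 0 \<or> B \<noteq> 0" using assms by auto
  then have "\<exists>D. D \<in> I \<and> D \<noteq> 0" using AI BI by blast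
  then obtain D where D: "D \<in> I" "D \<noteq> 0"
    and min: "\<And>E. E \<in> I \<Longrightarrow> E \<noteq> 0 \<Longrightarrow> degree D \<le> degree E"
    using ex_has_least_nat[of "\<lambda>D. D \<in> I \<and> D \<noteq> 0" _ degree] by blast
  obtain U V where UV: "D = U * A + V * B" using D(1) by (auto simp: I_def)
  have dvd: "primitive_part D dvd E" if E: "E \<in> I" for E
  proof -
    obtain q r where qr: "pseudo_divmod E D = (q, r)" by (cases "pseudo_divmod E D")
    define c where "c = lead_coeff D ^ (Suc (degree E) - degree D)"
    have c: "c \<noteq> 0" using D(2) by (simp add: c_def)
    have eq: "smult c E = D * q + r" and deg: "r = 0 \<or> degree r < degree D"
      using pseudo_divmod[OF D(2) qr] by (auto simp: c_def)
    obtain U' V' where "E = U' * A + V' * B" using E unfolding I_def by blast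
    then have "r = (smult c U' - q * U) * A + (smult c V' - q * V) * B"
      using eq UV by (simp add: algebra_simps smult_add_right)
    then have "r \<in> I" by (auto simp: I_def)
    then have "r = 0" using deg min[of r] by linarith
    moreover have "primitive_part D dvd D"
      by (metis content_times_primitive_part dvd_refl dvd_smult)
    ultimately have "primitive_part D dvd smult c E" using eq by simp
    \<comment> \<open>Gauss's lemma: over the fraction field the scalar \<open>c\<close> is a unit
      and drops out, and primitivity of the divisor brings the divisibility back.\<close>
    then have "fract_poly (primitive_part D) dvd fract_poly (smult c E)"
      by (rule fract_poly_dvd)
    then have "fract_poly (primitive_part D) dvd fract_poly E"
      using c by (simp add: dvd_smult_iff)
    then show ?thesis
      by (rule fract_poly_dvdD) (use D(2) in simp)
  qed
  have "is_unit (primitive_part D)"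
    using assms dvd[OF AI] dvd[OF BI] by (rule coprime_common_divisor)
  then have "degree D = 0" by (metis degree_primitive_part is_unit_poly_iff degree_pCons_0)
  then obtain d where "D = [:d:]" by (rule degree_eq_zeroE)
  then show ?thesis using UV D(2) by (metis pCons_eq_0_iff)
qed

text \<open>Unlike \<open>eval_xy\<close> it takes complex arguments, because polynomial identities
  are evaluated at non-real points later.\<close>

definition eval2 :: "complex poly poly \<Rightarrow> complex \<Rightarrow> complex \<Rightarrow> complex" where
  "eval2 P x y = poly (poly P [:y:]) x"

lemma eval2_simps [simp]:
  "eval2 (P + Q) x y = eval2 P x y + eval2 Q x y"
  "eval2 (P - Q) x y = eval2 P x y - eval2 Q x y"
  "eval2 (P * Q) x y = eval2 P x y * eval2 Q x y"
  "eval2 [:a:] x y = poly a x"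
  by (simp_all add: eval2_def)

lemma eval2_pCons: "eval2 (pCons a P) x y = poly a x + y * eval2 P x y"
  by (simp add: eval2_def)

lemma eval2_eq_poly: "eval2 P x y = poly (map_poly (\<lambda>a. poly a x) P) y"
  by (induction P) (simp_all add: eval2_pCons map_poly_pCons, simp add: eval2_def)

text \<open>The Bezout constant, a nonzero element of C[x], confines x to finitely many roots. Over
  each such x there are finitely many y, as otherwise a linear polynomial in x alone would divide
  both \<open>A\<close> and \<open>B\<close>.\<close>

lemma finite_common_zeros_coprime:
  fixes A B :: "complex poly poly"
  assumes "coprime A B"
  shows "finite {(x, y). eval2 A x y = 0 \<and> eval2 B x y = 0}"
proof -
  obtain U V d where d: "d \<noteq> 0" "U * A + V * B = [:d:]"
    using bezout_coprime_poly[OF assms] by blast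
  have sub: "{(x, y). eval2 A x y = 0 \<and> eval2 B x y = 0} \<subseteq>
    (SIGMA x:{x. poly d x = 0}. {y. eval2 A x y = 0 \<and> eval2 B x y = 0})"
  proof clarsimp
    fix x y assume "eval2 A x y = 0" "eval2 B x y = 0"
    then have "eval2 (U * A + V * B) x y = 0" by simp
    then show "poly d x = 0" using d by simp
  qed
  have "finite {y. eval2 A x y = 0 \<and> eval2 B x y = 0}" for x
  proof -
    \<comment> \<open>The divisor is X - x, constant in y. If \<open>P\<close> has infinitely many
      zeros on the vertical line over x, all its coefficients in C[X] vanish at x.\<close>
    have dvd: "[:[:-x, 1:]:] dvd P" if inf: "infinite {y. eval2 P x y = 0}" for P
    proof -
      have "map_poly (\<lambda>a. poly a x) P = 0"
        using poly_roots_finite inf by (force simp: eval2_eq_poly)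
      then have "coeff (map_poly (\<lambda>a. poly a x) P) k = 0" for k by simp
      then have "poly (coeff P k) x = 0" for k by (simp add: coeff_map_poly)
      then show ?thesis by (simp add: const_poly_dvd_iff poly_eq_0_iff_dvd)
    qed
    show ?thesis
    proof (rule ccontr)
      assume "infinite {y. eval2 A x y = 0 \<and> eval2 B x y = 0}"
      then have "infinite {y. eval2 A x y = 0}" "infinite {y. eval2 B x y = 0}"
        by (auto elim!: contrapos_nn intro: finite_subset[rotated])
      then have "is_unit [:[:-x, 1:]:]"
        using assms dvd coprime_common_divisor by blast
      then show False by (auto simp: is_unit_poly_iff)
    qed
  qed
  then show ?thesis
    using d(1) by (auto intro!: finite_subset[OF sub] finite_SigmaI simp: poly_roots_finite)
qed

section \<open>Total degree\<close>

lemma map_poly_mult_hom: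
  fixes f :: "'a::comm_semiring_1 \<Rightarrow> 'b::comm_semiring_1"
  assumes "f 0 = 0" "\<And>a b. f (a + b) = f a + f b" "\<And>a b. f (a * b) = f a * f b"
  shows "map_poly f (p * q) = map_poly f p * map_poly f q"
  by (rule poly_eqI)
    (simp add: coeff_map_poly coeff_mult assms flip: sum_comp_morphism[of f, unfolded o_def])

lemma map_poly_add_hom:
  assumes "f 0 = 0" "\<And>a b. f (a + b) = f a + f b"
  shows "map_poly f (p + q) = map_poly f p + map_poly f q"
  by (rule poly_eqI) (simp add: coeff_map_poly assms)

text \<open>The substitution \<open>x \<mapsto> t\<close>, \<open>y \<mapsto> s t\<close> from \<open>C[x][y]\<close> to \<open>C[s][t]\<close>: it is a ring
  homomorphism turning the total degree into the degree in \<open>t\<close>.\<close>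

definition blowup :: "complex poly poly \<Rightarrow> complex poly poly" where
  "blowup P = poly (map_poly (map_poly (\<lambda>c. [:c:])) P) [:0, [:0, 1:]:]"

lemma blowup_0 [simp]: "blowup 0 = 0"
  by (simp add: blowup_def)

lemma blowup_pCons:
  "blowup (pCons a P) = map_poly (\<lambda>c. [:c:]) a + [:0, [:0, 1:]:] * blowup P"
  by (simp add: blowup_def map_poly_pCons)

lemma blowup_add: "blowup (P + Q) = blowup P + blowup Q"
  by (simp add: blowup_def map_poly_add_hom)

lemma blowup_mult: "blowup (P * Q) = blowup P * blowup Q"
  by (simp add: blowup_def map_poly_mult_hom map_poly_add_hom)

text \<open>The monomial x^i y^j becomes s^j t^(i + j), so distinct monomials stay distinct and the
  coefficient of t^k records the homogeneous part of degree k.\<close>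

lemma coeff_blowup:
  "coeff (coeff (blowup P) k) j = (if j \<le> k then coeff (coeff P j) (k - j) else 0)"
proof (induction P arbitrary: j k)
  case (pCons a P)
  show ?case
    by (cases j; cases k) (simp_all add: blowup_pCons coeff_map_poly pCons.IH)
qed simp

lemma coeff_blowup_add: "coeff (coeff (blowup P) (i + j)) j = coeff (coeff P j) i"
  by (simp add: coeff_blowup)

lemma blowup_eq_0_iff [simp]: "blowup P = 0 \<longleftrightarrow> P = 0"
proof
  assume "blowup P = 0"
  then have "coeff (coeff P j) i = 0" for i j by (metis coeff_0 coeff_blowup_add)
  then show "P = 0" by (simp add: poly_eq_iff)
qed simp

lemma total_degree_eq_degree_blowup:
  assumes "P \<noteq> 0"
  shows "total_degree P = degree (blowup P)"
  unfolding total_degree_def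
proof (rule Max_eqI)
  have le: "i + j \<le> degree (blowup P)" if "coeff (coeff P j) i \<noteq> 0" for i j
    using that by (intro le_degree) (metis coeff_0 coeff_blowup_add)
  then have "{i + j |i j. coeff (coeff P j) i \<noteq> 0} \<subseteq> {..degree (blowup P)}" by auto
  then show "finite {i + j |i j. coeff (coeff P j) i \<noteq> 0}" by (rule finite_subset) simp
  show "m \<le> degree (blowup P)" if "m \<in> {i + j |i j. coeff (coeff P j) i \<noteq> 0}" for m
    using that le by auto
  have "lead_coeff (blowup P) \<noteq> 0" using assms by simp
  then obtain j where j: "coeff (lead_coeff (blowup P)) j \<noteq> 0" by (auto simp: poly_eq_iff)
  then have "j \<le> degree (blowup P)" "coeff (coeff P j) (degree (blowup P) - j) \<noteq> 0"
    by (auto simp: coeff_blowup split: if_splits)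
  then show "degree (blowup P) \<in> {i + j |i j. coeff (coeff P j) i \<noteq> 0}"
    by (intro CollectI exI[of _ j] exI[of _ "degree (blowup P) - j"]) auto
qed

text \<open>C[s][t] is an integral domain, so degrees in t add.\<close>

lemma total_degree_mult:
  assumes "P \<noteq> 0" "Q \<noteq> 0"
  shows "total_degree (P * Q) = total_degree P + total_degree Q"
  using assms by (simp add: total_degree_eq_degree_blowup blowup_mult degree_mult_eq)

lemma total_degree_eq_0E:
  assumes "total_degree P = 0" "P \<noteq> 0"
  obtains a where "P = [:[:a:]:]" "a \<noteq> 0"
proof
  have "coeff (coeff P j) i = 0" if "i + j > 0" for i j
    using that assms
    by (metis coeff_0 coeff_blowup_add coeff_eq_0 total_degree_eq_degree_blowup)
  then show eq: "P = [:[:coeff (coeff P 0) 0:]:]"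
    by (auto simp: poly_eq_iff coeff_pCons split: nat.splits)
  then show "coeff (coeff P 0) 0 \<noteq> 0" using assms(2) by (metis pCons_0_0)
qed

section \<open>Ridge polynomials\<close>

text \<open>The inner polynomial \<open>[:[:0, 1:], [:\<kappa>:]:]\<close> is the linear form x +
  \<kappa> y, so this is F(x + \<kappa> y) as an element of C[x][y].\<close>

definition ridge :: "complex poly \<Rightarrow> complex \<Rightarrow> complex poly poly" where
  "ridge F \<kappa> = poly (map_poly (\<lambda>c. [:[:c:]:]) F) [:[:0, 1:], [:\<kappa>:]:]"

lemma ridge_0 [simp]: "ridge 0 \<kappa> = 0"
  by (simp add: ridge_def)

lemma ridge_pCons: "ridge (pCons a F) \<kappa> = [:[:a:]:] + [:[:0, 1:], [:\<kappa>:]:] * ridge F \<kappa>"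
  by (simp add: ridge_def map_poly_pCons)

lemma eval2_ridge: "eval2 (ridge F \<kappa>) x y = poly F (x + \<kappa> * y)"
proof (induction F)
  case 0
  show ?case by (simp add: eval2_def)
next
  case (pCons a F)
  have "eval2 [:[:0, 1:], [:\<kappa>:]:] x y = x + \<kappa> * y" by (simp add: eval2_def)
  then show ?case by (simp only: ridge_pCons eval2_simps pCons.IH) simp
qed

text \<open>\<open>blowup\<close> sends x + \<kappa> y to (1 + \<kappa> s) t, so each factor raises
  the degree in t by at most one.\<close>

lemma degree_blowup_ridge: "degree (blowup (ridge F \<kappa>)) \<le> degree F"
proof (induction F)
  case (pCons a F)
  have lin: "blowup [:[:0, 1:], [:\<kappa>:]:] = [:0, [:1, \<kappa>:]:]"
    by (simp add: blowup_pCons map_poly_pCons)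
  have const: "blowup [:[:a:]:] = [:[:a:]:]"
    by (simp add: blowup_pCons map_poly_pCons)
  show ?case
  proof (cases "F = 0")
    case True
    then show ?thesis by (simp add: ridge_pCons const)
  next
    case False
    have "degree ([:0, [:1, \<kappa>:]:] * blowup (ridge F \<kappa>)) \<le> Suc (degree F)"
      using degree_mult_le[of "[:0, [:1, \<kappa>:]:]" "blowup (ridge F \<kappa>)"] pCons.IH by simp
    then show ?thesis
      using False by (simp only: ridge_pCons blowup_add blowup_mult lin const)
        (intro degree_add_le, simp_all)
  qed
qed simp

lemma total_degree_ridge_diff:
  assumes "ridge F \<kappa> - ridge G \<mu> \<noteq> 0"
  shows "total_degree (ridge F \<kappa> - ridge G \<mu>) \<le> max (degree F) (degree G)"
proof -
  have "blowup (ridge F \<kappa>) = blowup (ridge F \<kappa> - ridge G \<mu>) + blowup (ridge G \<mu>)"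
    by (simp flip: blowup_add)
  then have "blowup (ridge F \<kappa> - ridge G \<mu>) = blowup (ridge F \<kappa>) - blowup (ridge G \<mu>)"
    by (simp add: algebra_simps)
  then show ?thesis
    using assms degree_blowup_ridge[of F \<kappa>] degree_blowup_ridge[of G \<mu>]
    by (simp add: total_degree_eq_degree_blowup)
      (intro degree_diff_le, auto)
qed

text \<open>On the line x = -\<mu> y the right side is constantly G(0), while x + \<kappa> y takes
  every complex value there.\<close>

lemma ridge_diff_eq_0:
  assumes "ridge F \<kappa> = ridge G \<mu>" "\<kappa> \<noteq> \<mu>"
  shows "degree F = 0"
proof -
  have "poly F z = poly [:poly G 0:] z" for z
  proof -
    define y where "y = z / (\<kappa> - \<mu>)"
    have "poly F (- \<mu> * y + \<kappa> * y) = poly G (- \<mu> * y + \<mu> * y)"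
      using arg_cong[OF assms(1), of "\<lambda>P. eval2 P (- \<mu> * y) y"]
      unfolding eval2_ridge .
    moreover have "- \<mu> * y + \<kappa> * y = z"
      using assms(2) by (simp add: y_def flip: distrib_right diff_divide_distrib left_diff_distrib)
    ultimately show ?thesis by simp
  qed
  then have "F = [:poly G 0:]" by (simp add: poly_eq_poly_eq_iff[symmetric] fun_eq_iff)
  then show ?thesis by (metis degree_pCons_0)
qed

text \<open>Comparing the coefficients of v^0, ..., v^3 leaves a Vandermonde system with the
  distinct nodes 1, \<gamma>, -1, -\<gamma>. The bound on \<open>k\<close> keeps the four binomial
  coefficients nonzero.\<close>

lemma powers_of_linear_forms_independent:
  fixes a b c d \<gamma> :: complex
  assumes "k \<ge> 3" "\<gamma> \<noteq> 0" "\<gamma>\<^sup>2 \<noteq> 1"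
    and eq: "\<And>v. a * (1 + v)^k + b * (1 + \<gamma> * v)^k + c * (1 - v)^k + d * (1 - \<gamma> * v)^k = 0"
  shows "a = 0 \<and> b = 0"
proof -
  let ?p = "smult a ([:1, 1:]^k) + smult b ([:1, \<gamma>:]^k) + smult c ([:1, -1:]^k)
    + smult d ([:1, -\<gamma>:]^k)"
  have "poly ?p v = poly 0 v" for v
    using eq[of v] by (simp add: algebra_simps)
  then have p0: "?p = 0" by (simp only: poly_eq_poly_eq_iff[symmetric] fun_eq_iff) simp
  have moment: "a + b * \<gamma>^m + c * (-1)^m + d * (-\<gamma>)^m = 0" if "m \<le> 3" for m
  proof -
    have "of_nat (k choose m) * (a + b * \<gamma>^m + c * (-1)^m + d * (-\<gamma>)^m) = coeff ?p m"
      using that assms(1) by (simp add: coeff_linear_poly_power algebra_simps)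
    then show ?thesis using p0 that assms(1) by simp
  qed
  have m: "a + b + c + d = 0" "a + b * \<gamma> - c - d * \<gamma> = 0"
    "a + b * \<gamma>^2 + c + d * \<gamma>^2 = 0" "a + b * \<gamma>^3 - c - d * \<gamma>^3 = 0"
    using moment[of 0] moment[of 1] moment[of 2] moment[of 3] by simp_all
  \<comment> \<open>The even moments involve only a + c and b + d, the odd ones only a - c and b -
    d, so the system splits into two of size two.\<close>
  have "(\<gamma>\<^sup>2 - 1) * (b + d) = (a + b * \<gamma>^2 + c + d * \<gamma>^2) - (a + b + c + d)"
    by (simp add: algebra_simps)
  then have bd: "b + d = 0" using m assms(3) by simp
  have "\<gamma> * (\<gamma>\<^sup>2 - 1) * (b - d) = (a + b * \<gamma>^3 - c - d * \<gamma>^3) - (a + b * \<gamma> - c - d * \<gamma>)"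
    by (simp add: algebra_simps power2_eq_square power3_eq_cube)
  then have "b - d = 0" using m assms(2,3) by simp
  with bd have b: "b = 0" and d: "d = 0" by (simp_all add: add_eq_0_iff2)
  with m have "a + c = 0" "a - c = 0" by simp_all
  with b show ?thesis by (simp add: add_eq_0_iff2)
qed

text \<open>At x = t, y = -i t v the four arguments become t times 1 + v, 1 + \<gamma> v, 1 - v, 1 -
  \<gamma> v. The coefficient of t^k is then a linear relation between k-th powers.\<close>

lemma coeff_eq_0_of_ridge_identity:
  fixes F1 F2 E1 E2 :: "complex poly"
  assumes eq: "\<And>x y. b * (poly F1 (x + \<i> * y) - poly F2 (x + \<i> * \<gamma> * y))
      = a * (poly E1 (x + - \<i> * y) - poly E2 (x + - (\<i> * \<gamma>) * y))"
    and "b \<noteq> 0" "\<gamma> \<noteq> 0" "\<gamma>\<^sup>2 \<noteq> 1" "k \<ge> 3"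
  shows "coeff F1 k = 0 \<and> coeff F2 k = 0"
proof -
  have "b * coeff F1 k * (1 + v)^k + - b * coeff F2 k * (1 + \<gamma> * v)^k
     + - a * coeff E1 k * (1 - v)^k + a * coeff E2 k * (1 - \<gamma> * v)^k = 0" for v
  proof -
    let ?p = "smult b (pcompose F1 [:0, 1 + v:] - pcompose F2 [:0, 1 + \<gamma> * v:])
      - smult a (pcompose E1 [:0, 1 - v:] - pcompose E2 [:0, 1 - \<gamma> * v:])"
    have "poly ?p t = poly 0 t" for t
      using eq[of t "- \<i> * t * v"]
      by (simp add: poly_pcompose algebra_simps)
    then have "?p = 0" by (simp only: poly_eq_poly_eq_iff[symmetric] fun_eq_iff) simp
    then have "coeff ?p k = 0" by simp
    then show ?thesis by (simp add: coeff_pcompose_linear algebra_simps)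
  qed
  from powers_of_linear_forms_independent[OF assms(5,3,4) this] assms(2)
  show ?thesis by simp
qed

section \<open>Boundary values and algebraic curves\<close>

text \<open>The access path makes the \<open>THE\<close> description unique; without one, every
  value would satisfy it vacuously.\<close>

lemma boundary_value_eq:
  assumes "isCont f \<zeta>" "access_path D \<zeta> \<gamma>"
  shows "boundary_value D f \<zeta> = f \<zeta>"
proof -
  have lim: "((\<lambda>t. f (\<delta> t)) \<longlongrightarrow> f \<zeta>) (at_left 1)" if "access_path D \<zeta> \<delta>" for \<delta>
  proof -
    have "continuous_on {0..1} \<delta>" "\<delta> 1 = \<zeta>"
      using that by (auto simp: access_path_def path_def pathfinish_def)
    then have "(\<delta> \<longlongrightarrow> \<zeta>) (at_left 1)"
      using continuous_on_Icc_at_leftD[of 0 1 \<delta>] by simp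
    then show ?thesis using assms(1) isCont_tendsto_compose by blast
  qed
  then show ?thesis
    unfolding boundary_value_def
    by (intro the_equality) (use assms(2) tendsto_unique[OF trivial_limit_at_left_real] in blast)+
qed

lemma continuous_on_T_map: "continuous_on A (T_map \<beta>)"
  by (cases "\<beta> = 0")
    (auto simp: T_map_def[abs_def] Complex_eq divide_inverse intro!: continuous_intros)

lemma access_path_T_map:
  assumes "access_path D \<zeta> \<gamma>"
  shows "access_path (T_map \<beta> ` D) (T_map \<beta> \<zeta>) (T_map \<beta> \<circ> \<gamma>)"
  using assms unfolding access_path_def
  by (auto simp: pathfinish_compose intro!: path_continuous_image continuous_on_T_map)

text \<open>The frontier point nearest to a point of \<open>D\<close> is reached along a segment.\<close>

lemma frontier_subset_closure_accessible:
  assumes "open D"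
  shows "frontier D \<subseteq> closure (accessible_boundary_points D)"
proof
  fix \<zeta> assume \<zeta>: "\<zeta> \<in> frontier D"
  show "\<zeta> \<in> closure (accessible_boundary_points D)"
    unfolding closure_approachable
  proof (intro allI impI)
    fix e :: real assume "e > 0"
    have "\<zeta> \<in> closure D" using \<zeta> by (simp add: frontier_def)
    \<comment> \<open>Half of \<open>e\<close> suffices: the frontier point \<xi> nearest to
      \<open>z\<close> is no farther from \<open>z\<close> than \<zeta> is.\<close>
    then obtain z where z: "z \<in> D" "dist z \<zeta> < e / 2"
      using \<open>e > 0\<close> by (metis closure_approachable half_gt_zero)
    obtain \<xi> where \<xi>: "\<xi> \<in> frontier D" "\<And>w. w \<in> frontier D \<Longrightarrow> dist z \<xi> \<le> dist z w"
      using distance_attains_inf[OF frontier_closed] \<zeta> by blast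
    have "z \<noteq> \<xi>" using z(1) \<xi>(1) assms by (auto simp: frontier_def interior_open)
    \<comment> \<open>A connected set that meets \<open>D\<close> but not its frontier lies inside
      \<open>D\<close>.\<close>
    have "ball z (dist z \<xi>) \<inter> frontier D = {}" using \<xi>(2) by fastforce
    moreover have "z \<in> ball z (dist z \<xi>) \<inter> D" using z(1) \<open>z \<noteq> \<xi>\<close> by simp
    ultimately have ball: "ball z (dist z \<xi>) \<subseteq> D"
      using connected_Int_frontier[OF connected_ball, of z "dist z \<xi>" D] by blast
    have "access_path D \<xi> (linepath z \<xi>)"
      unfolding access_path_def
    proof (intro conjI ballI)
      fix t :: real assume t: "t \<in> {0..<1}"
      have "z - linepath z \<xi> t = t *\<^sub>R (z - \<xi>)"
        by (simp add: linepath_def algebra_simps)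
      then have "dist z (linepath z \<xi> t) = t * dist z \<xi>" using t by (simp add: dist_norm)
      then have "dist z (linepath z \<xi> t) < dist z \<xi>" using t \<open>z \<noteq> \<xi>\<close> by simp
      then show "linepath z \<xi> t \<in> D" using ball by auto
    qed simp_all
    then have "\<xi> \<in> accessible_boundary_points D"
      using \<xi>(1) by (auto simp: accessible_boundary_points_def)
    moreover have "dist \<xi> \<zeta> < e"
      using \<xi>(2)[OF \<zeta>] z(2) dist_triangle2[of \<xi> \<zeta> z] by (simp add: dist_commute)
    ultimately show "\<exists>y\<in>accessible_boundary_points D. dist y \<zeta> < e" by blast
  qed
qed

lemma continuous_on_eval_xy: "continuous_on A (\<lambda>z. eval2 P (Re z) (Im z))"
  by (induction P) (auto simp: eval2_pCons intro!: continuous_intros, simp add: eval2_def)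

lemma defines_curve_iff: "defines_curve P \<Gamma> \<longleftrightarrow> P \<noteq> 0 \<and> (\<forall>z\<in>\<Gamma>. eval2 P (Re z) (Im z) = 0)"
  by (simp add: defines_curve_def eval_xy_def eval2_def)

lemma vanish_on_closure:
  assumes "S \<subseteq> closure T" "\<And>z. z \<in> T \<Longrightarrow> eval2 P (Re z) (Im z) = 0" "z \<in> S"
  shows "eval2 P (Re z) (Im z) = 0"
  using continuous_constant_on_closure[OF continuous_on_eval_xy, of T P 0] assms by blast

lemma curve_order_le:
  assumes "defines_curve P \<Gamma>"
  shows "curve_order \<Gamma> \<le> total_degree P"
  unfolding curve_order_def using assms by (intro Least_le) blast

text \<open>The cofactors of \<open>gcd P Q\<close> have only finitely many common zeros, so \<open>gcd P Q\<close> itself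
  vanishes on \<open>\<Gamma>\<close>; by minimality of the degree the cofactors are constant.\<close>

lemma minimal_defining_poly_unique:
  assumes perfect: "\<And>z. z \<in> \<Gamma> \<Longrightarrow> z islimpt \<Gamma>"
    and P: "defines_curve P \<Gamma>" "total_degree P \<le> curve_order \<Gamma>"
    and Q: "defines_curve Q \<Gamma>" "total_degree Q \<le> curve_order \<Gamma>"
  shows "\<exists>a b. a \<noteq> 0 \<and> b \<noteq> 0 \<and> (\<forall>x y. b * eval2 P x y = a * eval2 Q x y)"
proof -
  have nz: "P \<noteq> 0" "Q \<noteq> 0" using P Q by (simp_all add: defines_curve_def)
  define G where "G = gcd P Q"
  have "G \<noteq> 0" using nz by (simp add: G_def)
  obtain A B where AB: "P = A * G" "Q = B * G" "coprime A B"
    using gcd_coprime_exists[of P Q] nz unfolding G_def by auto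
  define S where "S = {(x, y). eval2 A x y = 0 \<and> eval2 B x y = 0}"
  define Z where "Z = {z. (complex_of_real (Re z), complex_of_real (Im z)) \<in> S}"
  have "finite S" unfolding S_def by (rule finite_common_zeros_coprime[OF AB(3)])
  then have "finite Z"
    unfolding Z_def
    by (intro finite_vimageI[of S "\<lambda>z. (complex_of_real (Re z), complex_of_real (Im z))",
          unfolded vimage_def])
      (auto simp: inj_def complex_eq_iff)
  \<comment> \<open>As \<Gamma> has no isolated points, deleting the finite set \<open>Z\<close>
    leaves a dense subset of it.\<close>
  then have "z islimpt (\<Gamma> - Z)" if "z \<in> \<Gamma>" for z
    using islimpt_Un_finite[of Z z "\<Gamma> - Z"] perfect[OF that]
    by (metis Un_Diff_cancel islimpt_Un_finite islimpt_subset sup_commute sup_ge1)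
  then have "\<Gamma> \<subseteq> closure (\<Gamma> - Z)" by (auto simp: closure_def)
  moreover have "eval2 G (Re z) (Im z) = 0" if "z \<in> \<Gamma> - Z" for z
  proof -
    have "eval2 P (Re z) (Im z) = 0" "eval2 Q (Re z) (Im z) = 0"
      using that P Q by (auto simp: defines_curve_iff)
    then show ?thesis using that by (auto simp: AB Z_def S_def)
  qed
  ultimately have "eval2 G (Re z) (Im z) = 0" if "z \<in> \<Gamma>" for z
    using that by (rule vanish_on_closure)
  then have "defines_curve G \<Gamma>" using \<open>G \<noteq> 0\<close> by (simp add: defines_curve_iff)
  \<comment> \<open>Now deg A + deg G = deg P is at most the order, hence at most deg G, which
    forces deg A = 0; likewise for \<open>B\<close>.\<close>
  then have "curve_order \<Gamma> \<le> total_degree G" by (rule curve_order_le)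
  moreover have "A \<noteq> 0" "B \<noteq> 0" using nz AB by auto
  ultimately have "total_degree A = 0" "total_degree B = 0"
    using P(2) Q(2) \<open>G \<noteq> 0\<close> unfolding AB by (simp_all add: total_degree_mult)
  with \<open>A \<noteq> 0\<close> \<open>B \<noteq> 0\<close> obtain a b where "A = [:[:a:]:]" "a \<noteq> 0" "B = [:[:b:]:]" "b \<noteq> 0"
    by (metis total_degree_eq_0E)
  then show ?thesis by (intro exI[of _ a] exI[of _ b]) (simp only: AB eval2_simps, simp)
qed

text \<open>A connected set with more than one point has no isolated points.\<close>

lemma Jordan_curve_islimpt:
  assumes "Jordan_curve \<Gamma>" "z \<in> \<Gamma>"
  shows "z islimpt \<Gamma>"
proof -
  obtain g where g: "simple_path g" "path_image g = \<Gamma>"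
    using assms(1) by (auto simp: Jordan_curve_def)
  then have "connected \<Gamma>" using connected_simple_path_image by blast
  moreover have "\<Gamma> \<noteq> {x}" for x
    using g simple_path_image_uncountable by fastforce
  ultimately show ?thesis using assms(2) by (intro connected_imp_perfect)
qed

lemma Jordan_curve_frontier_inside:
  assumes "Jordan_curve \<Gamma>"
  shows "open (inside \<Gamma>)" "frontier (inside \<Gamma>) = \<Gamma>"
  using assms Jordan_inside_outside by (auto simp: Jordan_curve_def)

theorem theorem1:
  fixes \<beta> :: real and n :: nat and D :: "complex set" and F1 F2 :: "complex poly"
  assumes "0 < \<beta>" and "\<beta> < 1"
    and "n > 2"
    and "algebraic_boundary_of_order D n"
    and "L_special \<beta> D"
    and "admissible_pair \<beta> D (poly F1) (poly F2)"
  shows "max (degree F1) (degree F2) > n"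
proof (rule ccontr)
  assume "\<not> max (degree F1) (degree F2) > n"
  then have le_n: "max (degree F1) (degree F2) \<le> n" by (simp only: not_less)
  obtain \<Gamma> where \<Gamma>: "Jordan_curve \<Gamma>" "D = inside \<Gamma>" "curve_order \<Gamma> = n"
    using assms(4) by (auto simp: algebraic_boundary_of_order_def algebraic_curve_def)
  note D = Jordan_curve_frontier_inside[OF \<Gamma>(1), folded \<Gamma>(2)]
  define \<gamma> where "\<gamma> = complex_of_real (1 / \<beta>)"
  have "\<gamma> \<noteq> 0" using assms(1) by (simp add: \<gamma>_def)
  \<comment> \<open>The bounds on \<beta> enter here: they make 1, \<gamma>, -1, -\<gamma> pairwise
    distinct.\<close>
  have "(1 / \<beta>)\<^sup>2 > 1" using assms(1,2) by (simp add: one_less_power)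
  then have "\<gamma>\<^sup>2 \<noteq> 1" unfolding \<gamma>_def by (metis less_irrefl of_real_eq_1_iff of_real_power)
  then have "\<gamma> \<noteq> 1" by auto
  define Q where "Q = ridge F1 \<i> - ridge F2 (\<i> * \<gamma>)"
  \<comment> \<open>As \<gamma> is real, conjugating the coefficients of \<open>Q\<close> turns the
    slopes i and i\<gamma> into -i and -i\<gamma>.\<close>
  define Q' where "Q' = ridge (map_poly cnj F1) (- \<i>) - ridge (map_poly cnj F2) (- (\<i> * \<gamma>))"
  have F1_nonconst: "degree F1 \<noteq> 0"
  proof
    assume "degree F1 = 0"
    then obtain c where "F1 = [:c:]" by (rule degree_eq_zeroE)
    then have "poly F1 constant_on D" by (auto simp: constant_on_def)
    then show False using assms(6) by (simp add: admissible_pair_def)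
  qed
  have "Q \<noteq> 0"
    using ridge_diff_eq_0[of F1 \<i> F2 "\<i> * \<gamma>"] F1_nonconst \<open>\<gamma> \<noteq> 1\<close> by (auto simp: Q_def)
  have deg_cnj: "degree (map_poly cnj F) = degree F" for F
    by (rule degree_map_poly) simp
  have "Q' \<noteq> 0"
    using ridge_diff_eq_0[of "map_poly cnj F1" "- \<i>" "map_poly cnj F2" "- (\<i> * \<gamma>)"]
      F1_nonconst \<open>\<gamma> \<noteq> 1\<close> by (auto simp: Q'_def deg_cnj)
  have evQ: "eval2 Q (Re z) (Im z) = poly F1 z - poly F2 (T_map \<beta> z)" for z
  proof -
    have "Re z + \<i> * Im z = z" "Re z + \<i> * \<gamma> * Im z = T_map \<beta> z"
      by (simp_all add: complex_eq_iff T_map_def \<gamma>_def)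
    then show ?thesis by (simp add: Q_def eval2_ridge)
  qed
  have evQ': "eval2 Q' (Re z) (Im z) = cnj (eval2 Q (Re z) (Im z))" for z
    by (simp add: Q_def Q'_def eval2_ridge \<gamma>_def)
  have acc: "eval2 Q (Re z) (Im z) = 0" if z: "z \<in> accessible_boundary_points D" for z
  proof -
    obtain p where p: "access_path D z p"
      using z by (auto simp: accessible_boundary_points_def)
    have "boundary_value D (poly F1) z = poly F1 z"
      by (rule boundary_value_eq[OF _ p]) simp
    moreover have "boundary_value (T_map \<beta> ` D) (poly F2) (T_map \<beta> z) = poly F2 (T_map \<beta> z)"
      by (rule boundary_value_eq[OF _ access_path_T_map[OF p]]) simp
    ultimately show ?thesis
      using z assms(6) by (simp add: admissible_pair_def evQ)
  qed
  have Q: "defines_curve Q \<Gamma>"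
    using vanish_on_closure[OF frontier_subset_closure_accessible[OF D(1)] acc] D(2) \<open>Q \<noteq> 0\<close>
    by (auto simp: defines_curve_iff)
  then have Q': "defines_curve Q' \<Gamma>"
    using \<open>Q' \<noteq> 0\<close> by (simp add: defines_curve_iff evQ')
  have "total_degree Q \<le> max (degree F1) (degree F2)"
    using \<open>Q \<noteq> 0\<close> unfolding Q_def by (rule total_degree_ridge_diff)
  \<comment> \<open>The order \<open>n\<close> is at most deg Q, which is at most the maximum, which
    is at most \<open>n\<close>; equality holds throughout.\<close>
  then have n: "max (degree F1) (degree F2) = n" and dQ: "total_degree Q \<le> curve_order \<Gamma>"
    using le_n curve_order_le[OF Q] \<Gamma>(3) by auto
  have dQ': "total_degree Q' \<le> curve_order \<Gamma>"
    using total_degree_ridge_diff[OF \<open>Q' \<noteq> 0\<close>[unfolded Q'_def]] n \<Gamma>(3)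
    by (simp add: Q'_def deg_cnj)
  obtain a b where ab: "b \<noteq> 0" "\<And>x y. b * eval2 Q x y = a * eval2 Q' x y"
    using minimal_defining_poly_unique[OF Jordan_curve_islimpt[OF \<Gamma>(1)] Q dQ Q' dQ'] by blast
  have "coeff F1 n = 0 \<and> coeff F2 n = 0"
  proof (rule coeff_eq_0_of_ridge_identity)
    show "b * (poly F1 (x + \<i> * y) - poly F2 (x + \<i> * \<gamma> * y)) =
      a * (poly (map_poly cnj F1) (x + - \<i> * y) - poly (map_poly cnj F2) (x + - (\<i> * \<gamma>) * y))" for x y
      using ab(2)[of x y] unfolding Q_def Q'_def eval2_simps eval2_ridge .
  qed (use ab \<open>\<gamma> \<noteq> 0\<close> \<open>\<gamma>\<^sup>2 \<noteq> 1\<close> assms(3) in auto)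
  \<comment> \<open>One of the two polynomials has degree exactly \<open>n\<close>, and n > 0
    excludes the zero polynomial, whose \<open>degree\<close> is 0 by convention.\<close>
  moreover have "coeff F1 n \<noteq> 0 \<or> coeff F2 n \<noteq> 0"
    using n assms(3) by (cases "degree F1 = n") (auto simp: max_def split: if_splits)
  ultimately show False by blast
qed

end
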